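(* Let $\alpha,\lambda\in(0,\infty)$ and let $X\sim \mathrm{TSD}_1(\alpha,0,\lambda)$. Then for every $f\in\mathcal{S}(\mathbb{R})$, $$\mathbb{E}[Xf(X)]=\mathbb{E}[X]\;\mathbb{E}\left(f(X)+\frac{1}{\lambda}f'(X+Y)\right),$$ where $Y$ is a random variable having the exponential distribution with parameter (rate) $\lambda$, independent of $X$.
   Context: $\mathcal{S}(\mathbb{R})$ is the Schwartz space on $\mathbb{R}$. For $\alpha,\lambda\in(0,\infty)$, $\beta\in[0,1)$, a random variable $X$ has the one-sided tempered stable distribution $\mathrm{TSD}_1(\alpha,\beta,\lambda)$ if its characteristic function is $\mathbb{E}e^{izX}=\exp\left(\int_{0}^{\infty}(e^{izu}-1)\frac{\alpha}{u^{1+\beta}}e^{-\lambda u}\,du\right)$, $z\in\mathbb{R}$. For $\beta=0$ this is the Gamma distribution with shape $\alpha$ and rate $\lambda$. *)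

theory Defs
  imports "HOL-Probability.Probability"
begin

definition nth_vector_derivative :: "nat \<Rightarrow> (real \<Rightarrow> 'a) \<Rightarrow> real \<Rightarrow> 'a::real_normed_vector" where
  "nth_vector_derivative n f = ((\<lambda>g x. vector_derivative g (at x)) ^^ n) f"

definition schwartz_space :: "(real \<Rightarrow> 'a::real_normed_vector) set" where
  "schwartz_space = {f.
     (\<forall>n x. nth_vector_derivative n f differentiable at x) \<and>
     (\<forall>m n. bounded (range (\<lambda>x. x ^ m *\<^sub>R nth_vector_derivative n f x)))}"

text \<open>The parameter range is \<open>a > 0\<close>, \<open>0 \<le> b < 1\<close>, \<open>l > 0\<close>; there the integrand in the exponent is
  absolutely integrable for every \<open>z\<close>, so the Bochner integral carries no junk value.\<close>

definition has_TSD1 :: "'b measure \<Rightarrow> ('b \<Rightarrow> real) \<Rightarrow> real \<Rightarrow> real \<Rightarrow> real \<Rightarrow> bool" where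
  "has_TSD1 M X a b l \<longleftrightarrow>
     X \<in> borel_measurable M \<and>
     (\<forall>z::real. char (distr M borel X) z =
        exp (CLINT u:{0<..}|lborel.
               (iexp (z * u) - 1) * complex_of_real (a / u powr (1 + b) * exp (- l * u))))"

end

theory Submission
  imports Defs "HOL-Real_Asymp.Real_Asymp"
begin

text \<open>
  Write \<open>g\<^sub>a\<close> for the Gamma density with shape \<open>a\<close> and rate \<open>l\<close>. Everything rests on the two relations
  \<open>x g\<^sub>a(x) = (a / l) g\<^sub>a\<^sub>+\<^sub>1(x)\<close> and \<open>g\<^sub>a\<^sub>+\<^sub>1' = l (g\<^sub>a - g\<^sub>a\<^sub>+\<^sub>1)\<close>. The first turns \<open>E[X f(X)]\<close> into
  \<open>(a / l) \<integral> f g\<^sub>a\<^sub>+\<^sub>1\<close>, and integration by parts with the second gives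
  \<open>\<integral> f g\<^sub>a\<^sub>+\<^sub>1 = \<integral> f g\<^sub>a + (1 / l) \<integral> f' g\<^sub>a\<^sub>+\<^sub>1\<close>, which is the claim because \<open>X + Y\<close> has density
  \<open>g\<^sub>a\<^sub>+\<^sub>1\<close>. The same relations for \<open>f(x) = exp (i z x)\<close> show that the characteristic function of \<open>g\<^sub>a\<close>
  solves \<open>\<phi>' = i a / (l - i z) \<phi>\<close>. So does the exponential of the Levy--Khintchine exponent, and
  Levy's uniqueness theorem identifies the laws of \<open>X\<close> and \<open>X + Y\<close>.
\<close>

section \<open>Gamma densities: normalisation, shape shift, derivative and boundary limits\<close>

definition gamma_density :: "real \<Rightarrow> real \<Rightarrow> real \<Rightarrow> real" where
  "gamma_density a l x = (if x \<le> 0 then 0 else l powr a * x powr (a - 1) * exp (- l * x) / Gamma a)"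

lemma gamma_density_nonneg: "a > 0 \<Longrightarrow> 0 \<le> gamma_density a l x"
  by (simp add: gamma_density_def Gamma_real_nonneg)

lemma borel_measurable_gamma_density [measurable]:
  "gamma_density a l \<in> borel_measurable borel"
  unfolding gamma_density_def[abs_def] by measurable

lemma gamma_density_add_1:
  assumes "a > 0" "l > 0"
  shows "gamma_density (a + 1) l x = l / a * (x * gamma_density a l x)"
proof -
  have "Gamma (a + 1) = a * Gamma a"
    using assms by (intro Gamma_plus1) (auto elim!: nonpos_Ints_cases')
  moreover have "x powr a = x * x powr (a - 1)" if "x > 0"
    using that by (simp add: powr_mult_base)
  ultimately show ?thesis
    using assms by (simp add: gamma_density_def powr_add mult_ac)
qed

text \<open>Euler's integral for \<open>Gamma a\<close> after the substitution t -> l * t,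
  normalised by the factor \<open>l / Gamma a\<close>.\<close>

lemma has_bochner_integral_gamma_density:
  assumes a: "a > 0" and l: "l > 0"
  shows "has_bochner_integral lborel (gamma_density a l) 1"
proof -
  have G: "Gamma a > 0" using a by (rule Gamma_real_pos)
  have "has_bochner_integral lborel (\<lambda>t. indicator {0..} t * t powr (a - 1) / exp t) (Gamma a)"
    using Gamma_conv_nn_integral_real[OF a] G
    by (intro has_bochner_integral_nn_integral) auto
  then have "has_bochner_integral lborel
      (\<lambda>t. indicator {0..} (0 + l * t) * (0 + l * t) powr (a - 1) / exp (0 + l * t))
      (Gamma a /\<^sub>R \<bar>l\<bar>)"
    using l by (subst (asm) lborel_has_bochner_integral_real_affine_iff[where c = l and t = 0]) auto
  then have "has_bochner_integral lborel
      (\<lambda>t. l / Gamma a * (indicator {0..} (0 + l * t) * (0 + l * t) powr (a - 1) / exp (0 + l * t)))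
      (l / Gamma a * (Gamma a /\<^sub>R \<bar>l\<bar>))"
    by (intro has_bochner_integral_mult_right) auto
  \<comment> \<open>The indicator of \<open>{0..}\<close> includes t = 0, where the density is set
    to 0. The two sides still agree there, because \<open>0 powr (a - 1)\<close> is 0 by
    convention.\<close>
  moreover have "(\<lambda>t. l / Gamma a *
      (indicator {0..} (0 + l * t) * (0 + l * t) powr (a - 1) / exp (0 + l * t))) = gamma_density a l"
  proof
    fix t
    have "l powr a = l * l powr (a - 1)"
      using l by (simp add: powr_mult_base)
    then show "l / Gamma a * (indicator {0..} (0 + l * t) * (0 + l * t) powr (a - 1) / exp (0 + l * t))
        = gamma_density a l t"
      using l by (auto simp: gamma_density_def indicator_def zero_le_mult_iff powr_mult exp_minus field_simps)
  qed
  ultimately show ?thesis using G l by simp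
qed

text \<open>Only for x > 0: near 0 the function behaves like a multiple of x^a on the right and
  vanishes on the left, so for a <= 1 it is not differentiable at 0.\<close>

lemma has_real_derivative_gamma_density_add_1:
  assumes "a > 0" "l > 0" "x > 0"
  shows "(gamma_density (a + 1) l has_real_derivative
    l * (gamma_density a l x - gamma_density (a + 1) l x)) (at x)"
proof -
  have G: "Gamma (a + 1) = a * Gamma a"
    using assms by (intro Gamma_plus1) (auto elim!: nonpos_Ints_cases')
  have "((\<lambda>x. l powr (a + 1) * x powr a * exp (- l * x) / Gamma (a + 1)) has_real_derivative
    l * (gamma_density a l x - gamma_density (a + 1) l x)) (at x)"
    using assms Gamma_real_pos[OF assms(1), THEN less_imp_neq, symmetric] unfolding gamma_density_def G
    by (auto intro!: derivative_eq_intros simp: powr_add powr_diff field_simps)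
  then show ?thesis
    by (rule has_field_derivative_transform_within_open[where S = "{0<..}"])
       (use assms in \<open>auto simp: gamma_density_def\<close>)
qed

text \<open>With shape a + 1 the power of x is x^a with a > 0, which tends to 0. This limit and the
  one at infinity make the boundary terms of the integration by parts vanish.\<close>

lemma gamma_density_tendsto_0_at_right:
  assumes "a > 0" "l > 0"
  shows "(gamma_density (a + 1) l \<longlongrightarrow> 0) (at_right 0)"
proof -
  have "((\<lambda>x. l powr (a + 1) / Gamma (a + 1) * (x powr a * exp (- l * x))) \<longlongrightarrow>
      l powr (a + 1) / Gamma (a + 1) * 0) (at_right 0)"
    using assms by (intro tendsto_mult_left) real_asymp
  then show ?thesis
    by (subst tendsto_cong[where g = "\<lambda>x. l powr (a + 1) / Gamma (a + 1) * (x powr a * exp (- l * x))"])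
       (auto simp: gamma_density_def eventually_at_filter intro!: always_eventually)
qed

lemma gamma_density_tendsto_0_at_top:
  assumes "a > 0" "l > 0"
  shows "(gamma_density (a + 1) l \<longlongrightarrow> 0) at_top"
proof -
  have "((\<lambda>x. l powr (a + 1) / Gamma (a + 1) * (x powr a * exp (- l * x))) \<longlongrightarrow>
      l powr (a + 1) / Gamma (a + 1) * 0) at_top"
    using assms by (intro tendsto_mult_left) real_asymp
  then show ?thesis
    by (subst tendsto_cong[where g = "\<lambda>x. l powr (a + 1) / Gamma (a + 1) * (x powr a * exp (- l * x))"])
       (auto simp: gamma_density_def intro!: eventually_mono[OF eventually_gt_at_top[of 0]])
qed

section \<open>Integration by parts against Gamma densities\<close>

lemma integrable_bounded_mult_gamma_density:
  fixes h :: "real \<Rightarrow> complex"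
  assumes "a > 0" "l > 0" and [measurable]: "h \<in> borel_measurable borel"
    and B: "\<And>x. norm (h x) \<le> B"
  shows "integrable lborel (\<lambda>x. h x * complex_of_real (gamma_density a l x))"
proof (rule Bochner_Integration.integrable_bound)
  show "integrable lborel (\<lambda>x. B * gamma_density a l x)"
    using has_bochner_integral_gamma_density[OF assms(1,2)] by (auto simp: has_bochner_integral_iff)
  show "AE x in lborel. norm (h x * complex_of_real (gamma_density a l x)) \<le> norm (B * gamma_density a l x)"
    using order_trans[OF norm_ge_zero B] B gamma_density_nonneg[OF assms(1)]
    by (auto simp: norm_mult abs_mult intro!: mult_right_mono order_trans[OF B])
qed measurable

text \<open>The derivative of \<open>h x * gamma_density (a + 1) l x\<close> integrates to 0 over
  the positive half-line, and the product rule splits it into the three integrals. It is applied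
  both to the test function and to exp (i z x), hence the complex values.\<close>

lemma gamma_integral_by_parts:
  fixes h h' :: "real \<Rightarrow> complex"
  assumes a: "a > 0" and l: "l > 0"
    and h: "\<And>x. (h has_vector_derivative h' x) (at x)" and h': "continuous_on UNIV h'"
    and B: "\<And>x. norm (h x) \<le> B" and B': "\<And>x. norm (h' x) \<le> B'"
  shows "(CLINT x|lborel. h' x * complex_of_real (gamma_density (a + 1) l x)) =
    complex_of_real l * ((CLINT x|lborel. h x * complex_of_real (gamma_density (a + 1) l x)) -
      (CLINT x|lborel. h x * complex_of_real (gamma_density a l x)))"
proof -
  let ?g = "\<lambda>a x. complex_of_real (gamma_density a l x)"
  \<comment> \<open>The derivative of \<open>h x * ?g (a + 1) x\<close> for x > 0, by the product
    rule and the derivative of the density of shape a + 1.\<close>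
  let ?k = "\<lambda>x. h' x * ?g (a + 1) x + complex_of_real l * (h x * ?g a x - h x * ?g (a + 1) x)"
  have conth: "continuous_on UNIV h"
    using h by (meson continuous_at_imp_continuous_on has_vector_derivative_continuous)
  note [measurable] = borel_measurable_continuous_onI[OF conth] borel_measurable_continuous_onI[OF h']
  have int: "integrable lborel (\<lambda>x. h' x * ?g (a + 1) x)" "integrable lborel (\<lambda>x. h x * ?g a x)"
    "integrable lborel (\<lambda>x. h x * ?g (a + 1) x)"
    using a l B B' by (auto intro!: integrable_bounded_mult_gamma_density)
  then have intk: "integrable lborel ?k"
    by auto
  have lim0: "((\<lambda>x. h x * ?g (a + 1) x) \<longlongrightarrow> 0) F" if "(gamma_density (a + 1) l \<longlongrightarrow> 0) F" for F
  proof (rule Lim_null_comparison)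
    show "((\<lambda>x. B * \<bar>gamma_density (a + 1) l x\<bar>) \<longlongrightarrow> 0) F"
      using that by (auto intro!: tendsto_eq_intros)
    show "\<forall>\<^sub>F x in F. norm (h x * ?g (a + 1) x) \<le> B * \<bar>gamma_density (a + 1) l x\<bar>"
      using B by (auto simp: norm_mult intro!: mult_right_mono always_eventually)
  qed
  have "(LBINT x=0..\<infinity>. ?k x) = 0 - 0"
  proof (rule interval_integral_FTC_integrable[where F = "\<lambda>x. h x * ?g (a + 1) x"])
    fix x :: real assume "0 < ereal x"
    then have x: "x > 0" by simp
    have "((\<lambda>x. h x * ?g (a + 1) x) has_vector_derivative
      (h x * complex_of_real (l * (gamma_density a l x - gamma_density (a + 1) l x)) + h' x * ?g (a + 1) x)) (at x)"
      by (intro has_vector_derivative_mult h has_vector_derivative_of_real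
          has_real_derivative_gamma_density_add_1 a l x)
    then show "((\<lambda>x. h x * ?g (a + 1) x) has_vector_derivative ?k x) (at x)"
      by (simp add: algebra_simps)
    have "isCont (gamma_density (a + 1) l) x"
      using has_real_derivative_gamma_density_add_1[OF a l x] by (rule DERIV_isCont)
    \<comment> \<open>For a < 1 this density is unbounded near 0, but the fundamental theorem on the
      open interval asks for continuity only at points x > 0, together with integrability.\<close>
    moreover have "isCont (gamma_density a l) x"
    proof -
      have "isCont (\<lambda>x. l powr a * x powr (a - 1) * exp (- l * x) / Gamma a) x"
        using x Gamma_real_pos[OF a] by (intro continuous_intros) auto
      moreover have "\<forall>\<^sub>F y in nhds x. gamma_density a l y = l powr a * y powr (a - 1) * exp (- l * y) / Gamma a"
        using eventually_nhds_in_open[of "{0<..}" x] x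
        by (auto simp: gamma_density_def elim!: eventually_mono)
      ultimately show ?thesis by (simp add: isCont_cong)
    qed
    moreover have "isCont h x" "isCont h' x"
      using conth h' by (auto simp: continuous_on_eq_continuous_at)
    ultimately show "isCont ?k x"
      by (intro continuous_intros)
  next
    show "set_integrable lborel (einterval 0 \<infinity>) ?k"
      unfolding set_integrable_def using intk by (intro integrable_mult_indicator) auto
    show "(((\<lambda>x. h x * ?g (a + 1) x) \<circ> real_of_ereal) \<longlongrightarrow> 0) (at_right 0)"
      unfolding zero_ereal_def ereal_tendsto_simps
      by (intro lim0 gamma_density_tendsto_0_at_right a l)
    show "(((\<lambda>x. h x * ?g (a + 1) x) \<circ> real_of_ereal) \<longlongrightarrow> 0) (at_left \<infinity>)"
      unfolding ereal_tendsto_simps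
      by (intro lim0 gamma_density_tendsto_0_at_top a l)
  qed simp
  \<comment> \<open>Both densities vanish on x <= 0, so \<open>?k\<close> does too and the half-line
    carries the whole integral.\<close>
  moreover have "(LBINT x=0..\<infinity>. ?k x) = integral\<^sup>L lborel ?k"
    unfolding interval_lebesgue_integral_def set_lebesgue_integral_def
    by (auto intro!: Bochner_Integration.integral_cong
        simp: indicator_def einterval_def gamma_density_def not_less)
  ultimately show ?thesis
    using int by (simp add: algebra_simps)
qed

section \<open>Differentiation under the integral sign for Levy-Khintchine integrals\<close>

lemma norm_iexp_diff_le: "norm (iexp x - iexp y) \<le> \<bar>x - y\<bar>"
proof -
  have "iexp x - iexp y = iexp y * (iexp (x - y) - 1)"
    by (simp add: algebra_simps flip: exp_add)
  then show ?thesis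
    using iexp_approx1[of "x - y" 0] by (simp add: norm_mult)
qed

lemma has_vector_derivative_iexp_mult:
  "((\<lambda>x. iexp (z * x)) has_vector_derivative (\<i> * complex_of_real z * iexp (z * x))) (at x)"
proof -
  have "((iexp \<circ> (\<lambda>x. z * x)) has_vector_derivative (z *\<^sub>R (\<i> * iexp (z * x)))) (at x)"
    by (intro vector_diff_chain_at has_vector_derivative_iexp)
       (auto intro!: derivative_eq_intros simp flip: has_real_derivative_iff_has_vector_derivative)
  then show ?thesis
    by (simp add: o_def scaleR_conv_of_real mult_ac)
qed

text \<open>The weight \<open>w\<close> may fail to be integrable at 0, as the Levy density a exp (-
  l u) / u does; the bound |exp (i z u) - 1| <= |z u| supplies the missing factor u.\<close>

lemma integrable_iexp_minus_1_mult:
  fixes w :: "real \<Rightarrow> complex"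
  assumes [measurable]: "w \<in> borel_measurable borel"
    and w: "integrable lborel (\<lambda>u. complex_of_real u * w u)"
  shows "integrable lborel (\<lambda>u. (iexp (z * u) - 1) * w u)"
proof (rule Bochner_Integration.integrable_bound)
  show "integrable lborel (\<lambda>u. complex_of_real z * (complex_of_real u * w u))"
    using w by simp
  show "AE u in lborel. norm ((iexp (z * u) - 1) * w u) \<le> norm (complex_of_real z * (complex_of_real u * w u))"
    using norm_iexp_diff_le[of "z * _" 0]
    by (auto simp: norm_mult abs_mult simp flip: mult.assoc intro!: mult_right_mono)
qed measurable

text \<open>Dominated convergence for the difference quotients. The weight is general because the
  lemma serves twice: a Gamma density as \<open>w\<close> gives the derivative of a characteristic
  function, the Levy density gives that of the exponent in \<open>has_TSD1\<close>.\<close>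

lemma has_vector_derivative_integral_iexp:
  fixes w :: "real \<Rightarrow> complex"
  assumes [measurable]: "w \<in> borel_measurable borel"
    and w: "integrable lborel (\<lambda>u. complex_of_real u * w u)"
  shows "((\<lambda>z. CLINT u|lborel. (iexp (z * u) - 1) * w u) has_vector_derivative
    (CLINT u|lborel. \<i> * iexp (z * u) * (complex_of_real u * w u))) (at z)"
proof -
  let ?f = "\<lambda>z u. (iexp (z * u) - 1) * w u"
  let ?d = "\<lambda>u. \<i> * iexp (z * u) * (complex_of_real u * w u)"
  have intd: "integrable lborel ?d"
    by (rule Bochner_Integration.integrable_bound[OF w]) (auto simp: norm_mult)
  have intf: "integrable lborel (?f y)" for y
    by (rule integrable_iexp_minus_1_mult) fact+
  have deriv: "((\<lambda>y. ?f y u) has_vector_derivative ?d u) (at z)" for u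
  proof -
    have "((\<lambda>y. iexp (u * y) - 1) has_vector_derivative (\<i> * complex_of_real u * iexp (u * z) - 0)) (at z)"
      by (intro has_vector_derivative_diff has_vector_derivative_iexp_mult has_vector_derivative_const)
    from has_vector_derivative_mult_left[OF this, of "w u"]
    show ?thesis
      by (simp add: mult_ac)
  qed
  \<comment> \<open>The increment of \<open>?f\<close> and its linear part are each at most |y - z|
    |u w u|, hence the factor 2. For y = z the left side is 0, as
    \<open>inverse 0 = 0\<close>.\<close>
  have bound: "norm ((?f y u - ?f z u - (y - z) *\<^sub>R ?d u) /\<^sub>R norm (y - z)) \<le> 2 * norm (complex_of_real u * w u)"
    for y u
  proof -
    let ?r = "?f y u - ?f z u - (y - z) *\<^sub>R ?d u"
    have "norm ?r \<le> norm (?f y u - ?f z u) + norm ((y - z) *\<^sub>R ?d u)"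
      by (rule norm_triangle_ineq4)
    also have "norm (?f y u - ?f z u) \<le> \<bar>y - z\<bar> * (\<bar>u\<bar> * norm (w u))"
    proof -
      have "?f y u - ?f z u = (iexp (y * u) - iexp (z * u)) * w u"
        by (simp add: algebra_simps)
      moreover have "\<bar>y * u - z * u\<bar> = \<bar>y - z\<bar> * \<bar>u\<bar>"
        by (simp add: left_diff_distrib flip: abs_mult)
      ultimately show ?thesis
        using mult_right_mono[OF norm_iexp_diff_le[of "y * u" "z * u"], of "norm (w u)"]
        by (simp add: norm_mult)
    qed
    also have "norm ((y - z) *\<^sub>R ?d u) = \<bar>y - z\<bar> * (\<bar>u\<bar> * norm (w u))"
      by (simp add: norm_mult)
    finally have "norm ?r \<le> \<bar>y - z\<bar> * (2 * norm (complex_of_real u * w u))"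
      by (simp add: norm_mult mult_ac)
    then show ?thesis
      by (cases "y = z") (simp_all only: norm_scaleR, auto simp: divide_simps mult_ac)
  qed
  \<comment> \<open>This limit is what the derivative unfolds to. It is checked along sequences, the
    form in which dominated convergence applies.\<close>
  have "((\<lambda>y. (integral\<^sup>L lborel (?f y) - integral\<^sup>L lborel (?f z) - (y - z) *\<^sub>R integral\<^sup>L lborel ?d)
      /\<^sub>R norm (y - z)) \<longlongrightarrow> 0) (at z)"
    unfolding tendsto_at_iff_sequentially comp_def
  proof safe
    fix Y :: "nat \<Rightarrow> real" assume Y: "\<forall>i. Y i \<in> UNIV - {z}" "Y \<longlonglongrightarrow> z"
    have "(\<lambda>n. CLINT u|lborel. (?f (Y n) u - ?f z u - (Y n - z) *\<^sub>R ?d u) /\<^sub>R norm (Y n - z))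
        \<longlonglongrightarrow> (CLINT (u::real)|lborel. 0)"
    proof (rule integral_dominated_convergence)
      show "integrable lborel (\<lambda>u. 2 * norm (complex_of_real u * w u))"
        using w by (intro integrable_mult_right integrable_norm)
      show "AE u in lborel. (\<lambda>n. (?f (Y n) u - ?f z u - (Y n - z) *\<^sub>R ?d u) /\<^sub>R norm (Y n - z)) \<longlonglongrightarrow> 0"
      proof (rule AE_I2)
        fix u
        have "((\<lambda>y. (?f y u - ?f z u - (y - z) *\<^sub>R ?d u) /\<^sub>R norm (y - z)) \<longlongrightarrow> 0) (at z)"
          using deriv[of u] unfolding has_vector_derivative_def has_derivative_at_within by simp
        then show "(\<lambda>n. (?f (Y n) u - ?f z u - (Y n - z) *\<^sub>R ?d u) /\<^sub>R norm (Y n - z)) \<longlonglongrightarrow> 0"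
          using Y unfolding tendsto_at_iff_sequentially comp_def by blast
      qed
    qed (use bound in \<open>auto simp del: norm_scaleR\<close>)
    moreover have "(CLINT u|lborel. (?f y u - ?f z u - (y - z) *\<^sub>R ?d u) /\<^sub>R norm (y - z)) =
      (integral\<^sup>L lborel (?f y) - integral\<^sup>L lborel (?f z) - (y - z) *\<^sub>R integral\<^sup>L lborel ?d)
      /\<^sub>R norm (y - z)" for y
      using intf intd
      by (simp only: Bochner_Integration.integral_scaleR_right Bochner_Integration.integral_diff
          Bochner_Integration.integrable_diff integrable_scaleR_right)
    ultimately show "(\<lambda>n. (integral\<^sup>L lborel (?f (Y n)) - integral\<^sup>L lborel (?f z) -
        (Y n - z) *\<^sub>R integral\<^sup>L lborel ?d) /\<^sub>R norm (Y n - z)) \<longlonglongrightarrow> 0"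
      by (simp only: Bochner_Integration.integral_zero)
  qed
  then show ?thesis
    unfolding has_vector_derivative_def has_derivative_at_within
    by (auto intro: bounded_linear_scaleR_left)
qed


section \<open>Characteristic function of the Gamma law\<close>

lemma integral_gamma_distribution:
  fixes h :: "real \<Rightarrow> complex"
  assumes "a > 0" and [measurable]: "h \<in> borel_measurable borel"
  shows "integral\<^sup>L (density lborel (gamma_density a l)) h =
    (CLINT x|lborel. h x * complex_of_real (gamma_density a l x))"
  using gamma_density_nonneg[OF assms(1)]
  by (subst integral_density) (auto simp: scaleR_conv_of_real mult.commute)

lemma real_distribution_gamma:
  assumes "a > 0" "l > 0"
  shows "real_distribution (density lborel (gamma_density a l))"
proof -
  have "(\<integral>\<^sup>+x. ennreal (gamma_density a l x) \<partial>lborel) = ennreal 1"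
    using has_bochner_integral_gamma_density[OF assms] gamma_density_nonneg[OF assms(1)]
    by (subst nn_integral_eq_integral) (auto simp: has_bochner_integral_iff)
  then have "prob_space (density lborel (gamma_density a l))"
    by (intro prob_spaceI) (simp add: emeasure_density)
  then show ?thesis
    by (simp add: real_distribution_def real_distribution_axioms_def)
qed

lemma of_real_minus_i_times_neq_0: "l > 0 \<Longrightarrow> complex_of_real l - \<i> * complex_of_real z \<noteq> 0"
  by (auto simp: complex_eq_iff)

text \<open>Integration by parts with h = exp (i z x) and h' = i z h. Raising the shape by one thus
  multiplies the characteristic function by l / (l - i z), the one of an exponential
  variable.\<close>

lemma char_gamma_add_1:
  assumes a: "a > 0" and l: "l > 0"
  shows "(complex_of_real l - \<i> * complex_of_real z) * char (density lborel (gamma_density (a + 1) l)) z =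
    complex_of_real l * char (density lborel (gamma_density a l)) z"
proof -
  have "(CLINT x|lborel. (\<i> * complex_of_real z * iexp (z * x)) * complex_of_real (gamma_density (a + 1) l x)) =
    complex_of_real l * ((CLINT x|lborel. iexp (z * x) * complex_of_real (gamma_density (a + 1) l x)) -
      (CLINT x|lborel. iexp (z * x) * complex_of_real (gamma_density a l x)))"
    by (rule gamma_integral_by_parts[OF a l has_vector_derivative_iexp_mult, where B = 1 and B' = "\<bar>z\<bar>"])
       (auto intro!: continuous_intros simp: norm_mult)
  then show ?thesis
    using a by (simp add: char_def integral_gamma_distribution algebra_simps)
qed

text \<open>Differentiation brings down i x, the factor x raises the shape to a + 1, and
  \<open>char_gamma_add_1\<close> lowers it again, which closes the differential equation.\<close>

lemma has_vector_derivative_char_gamma: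
  assumes a: "a > 0" and l: "l > 0"
  shows "(char (density lborel (gamma_density a l)) has_vector_derivative
    \<i> * complex_of_real a / (complex_of_real l - \<i> * complex_of_real z) *
      char (density lborel (gamma_density a l)) z) (at z)"
proof -
  let ?g = "\<lambda>x. complex_of_real (gamma_density a l x)"
  have mult: "complex_of_real x * ?g x = complex_of_real (a / l) * complex_of_real (gamma_density (a + 1) l x)" for x
    using a l by (simp add: gamma_density_add_1)
  have int1: "integrable lborel (\<lambda>x. complex_of_real x * ?g x)"
    unfolding mult using integrable_bounded_mult_gamma_density[of "a + 1" l "\<lambda>_. 1" 1] a l
    by (intro integrable_mult_right) auto
  have int: "integrable lborel (\<lambda>x. iexp (z * x) * ?g x)" for z
    using a l by (intro integrable_bounded_mult_gamma_density[where B = 1]) auto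
  have tot: "integrable lborel ?g" "integral\<^sup>L lborel ?g = 1"
    using has_bochner_integral_gamma_density[OF a l] by (auto simp: has_bochner_integral_iff)
  \<comment> \<open>Total mass 1 is split off, to reach the form with
    \<open>iexp (z * u) - 1\<close> that the differentiation lemma treats.\<close>
  have "char (density lborel (gamma_density a l)) = (\<lambda>z. 1 + (CLINT u|lborel. (iexp (z * u) - 1) * ?g u))"
    using int tot a by (simp add: char_def integral_gamma_distribution left_diff_distrib fun_eq_iff)
  moreover have "((\<lambda>z. 1 + (CLINT u|lborel. (iexp (z * u) - 1) * ?g u)) has_vector_derivative
      (0 + (CLINT u|lborel. \<i> * iexp (z * u) * (complex_of_real u * ?g u)))) (at z)"
    using int1 by (intro has_vector_derivative_add has_vector_derivative_const has_vector_derivative_integral_iexp) auto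
  moreover have "(CLINT u|lborel. \<i> * iexp (z * u) * (complex_of_real u * ?g u)) =
      \<i> * complex_of_real a / complex_of_real l * char (density lborel (gamma_density (a + 1) l)) z"
  proof -
    have "(CLINT u|lborel. \<i> * iexp (z * u) * (complex_of_real u * ?g u)) =
      (CLINT u|lborel. \<i> * complex_of_real a / complex_of_real l * (iexp (z * u) * complex_of_real (gamma_density (a + 1) l u)))"
      unfolding mult by (intro Bochner_Integration.integral_cong) auto
    then show ?thesis
      using a by (simp add: char_def integral_gamma_distribution)
  qed
  moreover have "\<i> * complex_of_real a / complex_of_real l * char (density lborel (gamma_density (a + 1) l)) z =
    \<i> * complex_of_real a / (complex_of_real l - \<i> * complex_of_real z) * char (density lborel (gamma_density a l)) z"
    using char_gamma_add_1[OF a l, of z] of_real_minus_i_times_neq_0[OF l, of z] l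
    by (simp add: frac_eq_eq mult_ac)
  ultimately show ?thesis by simp
qed

lemma char_at_0_gamma:
  assumes "a > 0" "l > 0"
  shows "char (density lborel (gamma_density a l)) 0 = 1"
proof -
  interpret real_distribution "density lborel (gamma_density a l)"
    using assms by (rule real_distribution_gamma)
  show ?thesis by (rule char_zero)
qed

text \<open>For a = 1 the differential equation says that (l - i z) times the characteristic
  function has derivative 0; its constant value is the one at z = 0, namely l.\<close>

lemma char_gamma_1:
  assumes l: "l > 0"
  shows "char (density lborel (gamma_density 1 l)) z =
    complex_of_real l / (complex_of_real l - \<i> * complex_of_real z)"
proof -
  let ?c = "\<lambda>z. complex_of_real l - \<i> * complex_of_real z"
  let ?p = "char (density lborel (gamma_density 1 l))"
  have "((\<lambda>z. ?c z * ?p z) has_vector_derivative 0) (at z)" for z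
  proof -
    have "((\<lambda>z. ?c z) has_vector_derivative (0 - \<i> * complex_of_real 1)) (at z)"
      by (intro has_vector_derivative_diff has_vector_derivative_const has_vector_derivative_mult_right
          has_vector_derivative_of_real DERIV_ident)
    from has_vector_derivative_mult[OF this has_vector_derivative_char_gamma[OF zero_less_one l]]
    show ?thesis
      using of_real_minus_i_times_neq_0[OF l, of z] l by simp
  qed
  then obtain k where "\<And>z. ?c z * ?p z = k"
    using has_vector_derivative_zero_constant[of UNIV "\<lambda>z. ?c z * ?p z"] by auto
  from this[of z] this[of 0] show ?thesis
    using char_at_0_gamma[OF zero_less_one l] of_real_minus_i_times_neq_0[OF l, of z]
    by (simp add: field_simps)
qed

text \<open>Both sides solve the same linear differential equation with value 1 at z = 0, so no
  branch of the complex power (1 - i z / l)^(-a) has to be chosen. The exponent \<open>1 + 0\<close>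
  is the \<open>1 + b\<close> of \<open>has_TSD1\<close> at b = 0.\<close>

lemma char_gamma:
  assumes a: "a > 0" and l: "l > 0"
  shows "char (density lborel (gamma_density a l)) z =
    exp (CLINT u:{0<..}|lborel. (iexp (z * u) - 1) * complex_of_real (a / u powr (1 + 0) * exp (- l * u)))"
proof -
  define w where "w u = indicator {0<..} u *\<^sub>R complex_of_real (a / u powr (1 + 0) * exp (- l * u))" for u
  have [measurable]: "w \<in> borel_measurable borel"
    unfolding w_def[abs_def] by measurable
  define \<psi> where "\<psi> z = (CLINT u|lborel. (iexp (z * u) - 1) * w u)" for z
  let ?p = "char (density lborel (gamma_density a l))"
  \<comment> \<open>The factor u cancels the singularity of the Levy density and leaves a multiple
    of the exponential density, so the derivative of \<open>\<psi>\<close> is computed by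
    \<open>char_gamma_1\<close>.\<close>
  have mult: "complex_of_real u * w u = complex_of_real (a / l) * complex_of_real (gamma_density 1 l u)" for u
    using l by (auto simp: w_def gamma_density_def indicator_def)
  have "integrable lborel (\<lambda>u. complex_of_real u * w u)"
    unfolding mult using integrable_bounded_mult_gamma_density[of 1 l "\<lambda>_. 1" 1] l
    by (intro integrable_mult_right) auto
  then have "(\<psi> has_vector_derivative (CLINT u|lborel. \<i> * iexp (z * u) * (complex_of_real u * w u))) (at z)" for z
    unfolding \<psi>_def[abs_def] by (intro has_vector_derivative_integral_iexp) auto
  moreover have "(CLINT u|lborel. \<i> * iexp (z * u) * (complex_of_real u * w u)) =
    \<i> * complex_of_real a / (complex_of_real l - \<i> * complex_of_real z)" for z
  proof -
    have "(CLINT u|lborel. \<i> * iexp (z * u) * (complex_of_real u * w u)) =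
      (CLINT u|lborel. \<i> * complex_of_real a / complex_of_real l * (iexp (z * u) * complex_of_real (gamma_density 1 l u)))"
      unfolding mult by (intro Bochner_Integration.integral_cong) auto
    also have "\<dots> = \<i> * complex_of_real a / complex_of_real l * char (density lborel (gamma_density 1 l)) z"
      by (simp add: char_def integral_gamma_distribution)
    finally show ?thesis
      using l by (simp add: char_gamma_1)
  qed
  ultimately have \<psi>': "(\<psi> has_vector_derivative \<i> * complex_of_real a / (complex_of_real l - \<i> * complex_of_real z)) (at z)" for z
    by simp
  \<comment> \<open>The logarithmic derivatives of \<open>?p\<close> and of exp
    \<open>\<psi>\<close> coincide, so their quotient is constant.\<close>
  have "((\<lambda>z. ?p z * exp (- \<psi> z)) has_vector_derivative 0) (at z)" for z
  proof -
    have "((exp \<circ> (\<lambda>z. - \<psi> z)) has_vector_derivative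
        - (\<i> * complex_of_real a / (complex_of_real l - \<i> * complex_of_real z)) * exp (- \<psi> z)) (at z)"
      by (intro field_vector_diff_chain_at has_vector_derivative_minus \<psi>' DERIV_exp)
    from has_vector_derivative_mult[OF has_vector_derivative_char_gamma[OF a l] this[unfolded o_def]]
    show ?thesis by (simp add: algebra_simps)
  qed
  then obtain k where "\<And>z. ?p z * exp (- \<psi> z) = k"
    using has_vector_derivative_zero_constant[of UNIV "\<lambda>z. ?p z * exp (- \<psi> z)"] by auto
  from this[of z] this[of 0] have "?p z * exp (- \<psi> z) = 1"
    using char_at_0_gamma[OF a l] by (simp add: \<psi>_def)
  then have "?p z = exp (\<psi> z)"
    by (simp add: exp_minus field_simps)
  also have "\<psi> z = (CLINT u:{0<..}|lborel. (iexp (z * u) - 1) * complex_of_real (a / u powr (1 + 0) * exp (- l * u)))"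
    unfolding \<psi>_def w_def set_lebesgue_integral_def
    by (intro Bochner_Integration.integral_cong) auto
  finally show ?thesis .
qed

section \<open>Schwartz functions and the identity for X\<close>

lemma schwartz_spaceD:
  fixes f :: "real \<Rightarrow> 'a::real_normed_vector"
  assumes "f \<in> schwartz_space"
  shows "(f has_vector_derivative vector_derivative f (at x)) (at x)"
    and "continuous_on UNIV (\<lambda>x. vector_derivative f (at x))"
    and "bounded (range f)" and "bounded (range (\<lambda>x. vector_derivative f (at x)))"
proof -
  have d: "nth_vector_derivative n f differentiable at x"
    and b: "bounded (range (\<lambda>x. x ^ m *\<^sub>R nth_vector_derivative n f x))" for m n x
    using assms by (auto simp: schwartz_space_def)
  have 0: "nth_vector_derivative 0 f = f" "nth_vector_derivative 1 f = (\<lambda>x. vector_derivative f (at x))"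
    by (auto simp: nth_vector_derivative_def)
  show "(f has_vector_derivative vector_derivative f (at x)) (at x)"
    using d[of 0 x] by (simp add: 0 vector_derivative_works)
  show "continuous_on UNIV (\<lambda>x. vector_derivative f (at x))"
    using d[of 1, unfolded 0] by (auto intro!: continuous_at_imp_continuous_on differentiable_imp_continuous_within)
  show "bounded (range f)" "bounded (range (\<lambda>x. vector_derivative f (at x)))"
    using b[of 0 0, unfolded 0] b[of 0 1, unfolded 0] by auto
qed

theorem corollary3p5:
  fixes M :: "'b measure" and X Y :: "'b \<Rightarrow> real" and a l :: real
    and f :: "real \<Rightarrow> complex"
  assumes "prob_space M"
    and "a > 0" and "l > 0"
    and "has_TSD1 M X a 0 l"
    and "distributed M lborel Y (exponential_density l)"
    and "prob_space.indep_var M borel X borel Y"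
    and "f \<in> schwartz_space"
  shows "(\<integral>\<omega>. complex_of_real (X \<omega>) * f (X \<omega>) \<partial>M) =
    complex_of_real (\<integral>\<omega>. X \<omega> \<partial>M) *
      (\<integral>\<omega>. f (X \<omega>) + complex_of_real (1 / l) * vector_derivative f (at (X \<omega> + Y \<omega>)) \<partial>M)"
proof -
  interpret prob_space M by fact
  note a = \<open>a > 0\<close> and l = \<open>l > 0\<close>
  let ?f' = "\<lambda>x. vector_derivative f (at x)"
  let ?g = "\<lambda>a x. complex_of_real (gamma_density a l x)"
  note f = schwartz_spaceD[OF \<open>f \<in> schwartz_space\<close>]
  obtain B where B: "\<And>x. norm (f x) \<le> B"
    using f(3) by (auto simp: bounded_iff)
  obtain B' where B': "\<And>x. norm (?f' x) \<le> B'"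
    using f(4) by (auto simp: bounded_iff)
  have "continuous_on UNIV f"
    using f(1) by (meson continuous_at_imp_continuous_on has_vector_derivative_continuous)
  then have [measurable]: "f \<in> borel_measurable borel" "?f' \<in> borel_measurable borel"
    using f(2) by (auto intro: borel_measurable_continuous_onI)
  have X[measurable]: "X \<in> borel_measurable M"
    and charX: "char (distr M borel X) = char (density lborel (gamma_density a l))"
    using assms(4) a l by (auto simp: has_TSD1_def char_gamma fun_eq_iff simp del: add_0_right)
  have Y[measurable]: "Y \<in> borel_measurable M"
    using distributed_measurable[OF assms(5)] by simp
  have distX: "distr M borel X = density lborel (gamma_density a l)"
    using a l charX by (intro Levy_uniqueness real_distribution_gamma real_distribution_distr X) auto
  have "distr M borel Y = distr M lborel Y"
    by (intro distr_cong) auto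
  also have "\<dots> = density lborel (exponential_density l)"
    using assms(5) by (rule distributed_distr_eq_density)
  \<comment> \<open>The densities differ at 0, where the exponential one equals l and the Gamma one
    0; a single point is a null set.\<close>
  also have "\<dots> = density lborel (gamma_density 1 l)"
    using l by (intro density_cong eventually_mono[OF AE_lborel_singleton[of 0]])
               (auto simp: exponential_density_def gamma_density_def)
  finally have distY: "distr M borel Y = density lborel (gamma_density 1 l)" .
  \<comment> \<open>By independence the characteristic functions multiply, and the factor l / (l - i
    z) coming from Y raises the shape by one.\<close>
  have "char (distr M borel (\<lambda>\<omega>. X \<omega> + Y \<omega>)) z = char (density lborel (gamma_density (a + 1) l)) z" for z
    using char_gamma_add_1[OF a l, of z] of_real_minus_i_times_neq_0[OF l, of z]
    by (simp add: char_distr_add[OF assms(6)] distX distY char_gamma_1[OF l] field_simps)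
  then have distXY: "distr M borel (\<lambda>\<omega>. X \<omega> + Y \<omega>) = density lborel (gamma_density (a + 1) l)"
    using a l by (intro Levy_uniqueness real_distribution_gamma real_distribution_distr) auto
  have EX: "(\<integral>\<omega>. h (X \<omega>) \<partial>M) = (CLINT x|lborel. h x * ?g a x)"
    if [measurable]: "h \<in> borel_measurable borel" for h :: "real \<Rightarrow> complex"
    using integral_distr[OF X that] integral_gamma_distribution[OF a that] by (simp add: distX)
  have EXY: "(\<integral>\<omega>. ?f' (X \<omega> + Y \<omega>) \<partial>M) = (CLINT x|lborel. ?f' x * ?g (a + 1) x)"
    using integral_distr[of "\<lambda>\<omega>. X \<omega> + Y \<omega>" M borel ?f'] integral_gamma_distribution[of "a + 1" ?f' l] a
    by (simp add: distXY)
  \<comment> \<open>Used with h = 1 for the mean a / l and with h = f x for E[X f(X)]; both produce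
    the same factor a / l.\<close>
  have mult: "complex_of_real x * h * ?g a x = complex_of_real (a / l) * (h * ?g (a + 1) x)" for x h
    using a l by (simp add: gamma_density_add_1)
  have "complex_of_real (\<integral>\<omega>. X \<omega> \<partial>M) = (CLINT \<omega>|M. complex_of_real (X \<omega>) * 1)"
    by simp
  also have "\<dots> = complex_of_real (a / l)"
    using has_bochner_integral_gamma_density[of "a + 1" l] a l
    by (subst EX) (simp_all only: mult integral_mult_right_zero, auto simp: has_bochner_integral_iff)
  finally have mean: "complex_of_real (\<integral>\<omega>. X \<omega> \<partial>M) = complex_of_real (a / l)" .
  have "(\<integral>\<omega>. complex_of_real (X \<omega>) * f (X \<omega>) \<partial>M) = complex_of_real (a / l) * (CLINT x|lborel. f x * ?g (a + 1) x)"
    by (subst EX) (simp_all only: mult integral_mult_right_zero, measurable)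
  \<comment> \<open>The integration by parts formula divided by l and solved for the integral of f
    against shape a + 1.\<close>
  also have "(CLINT x|lborel. f x * ?g (a + 1) x) =
      (CLINT x|lborel. f x * ?g a x) + complex_of_real (1 / l) * (CLINT x|lborel. ?f' x * ?g (a + 1) x)"
    using gamma_integral_by_parts[OF a l f(1) f(2) B B'] l by (simp add: field_simps)
  also have "\<dots> = (\<integral>\<omega>. f (X \<omega>) \<partial>M) + complex_of_real (1 / l) * (\<integral>\<omega>. ?f' (X \<omega> + Y \<omega>) \<partial>M)"
    by (simp add: EX EXY)
  also have "\<dots> = (\<integral>\<omega>. f (X \<omega>) + complex_of_real (1 / l) * ?f' (X \<omega> + Y \<omega>) \<partial>M)"
  proof -
    \<comment> \<open>Bounded measurable functions are integrable on a probability space, which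
      justifies joining the two expectations.\<close>
    have "integrable M (\<lambda>\<omega>. f (X \<omega>))" "integrable M (\<lambda>\<omega>. ?f' (X \<omega> + Y \<omega>))"
      using B B' by (auto intro!: integrable_const_bound)
    then show ?thesis by simp
  qed
  finally show ?thesis
    by (simp only: mean)
qed

end
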